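(* Let $\mathcal{A}$ be a C$^\ast$-algebra and let $K\subseteq[-1,1]$ be a set having $0$ as a limit point. Then: (i) The functional $\|\cdot\|_K$ defined by $\|F\|_K=\sup_{t\in K}\left\|\sum_{n=0}^\infty a_nt^n\right\|$ for all $F=F(Z)=\sum_{n=0}^\infty a_nZ^n\in\mathcal{A}[Z]$ is a norm. (ii) $(\mathcal{A}[Z],\ast,\|\cdot\|_K)$ is a pre-C$^\ast$-algebra but not a C$^\ast$-algebra. (iii) $\|F\|_K\le\|F\|$ for all $F\in\mathcal{A}[Z]$, where $\|F\|=\sum_{n=0}^\infty\|a_n\|$ for $F=\sum_{n=0}^\infty a_nZ^n$. (iv) If $F(Z)=\sum_{n=0}^\infty a_nZ^n\in\mathcal{A}[Z]$, then $\sum_{n=0}^N a_nZ^n\to F(Z)$ in $\|\cdot\|_K$ as $N\to\infty$.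
   Context: All C$^\ast$-algebras are complex. $\mathcal{A}[Z]$ is the $\ast$-algebra of all formal power series $F(Z)=\sum_{n=0}^\infty a_nZ^n$ with $a_n\in\mathcal{A}$ and $\sum_{n=0}^\infty\|a_n\|<\infty$, with coefficientwise linear operations, Cauchy product $(\sum a_nZ^n)(\sum b_nZ^n)=\sum_n(\sum_{k=0}^n a_kb_{n-k})Z^n$, and involution $(\sum a_nZ^n)^\ast=\sum a_n^\ast Z^n$. A pre-C$^\ast$-algebra is a normed $\ast$-algebra (not necessarily complete) whose norm satisfies $\|x^\ast x\|=\|x\|^2$; a C$^\ast$-algebra is a complete one.
   Formalization: In (ii), the claim that A[Z] is not a C*-algebra is stated only for nonzero A, since for A = 0 the algebra A[Z] = 0 is complete and hence a C*-algebra; everything else is stated for every A. *)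

theory Defs
  imports
    "HOL-Analysis.Analysis"
    "HOL-Computational_Algebra.Formal_Power_Series"
begin

text \<open>
  Complex star-algebras are given by a carrier S inside a type whose ring operations are those of
  class \<open>ring\<close> (no unit is required), together with an explicit complex scalar multiplication and
  an explicit involution. A whole type is treated as an algebra by taking \<open>S = UNIV\<close>.
\<close>

locale complex_star_algebra =
  fixes S :: "'b::ring set"
    and scal :: "complex \<Rightarrow> 'b \<Rightarrow> 'b"
    and star :: "'b \<Rightarrow> 'b"
  assumes zero_closed: "0 \<in> S"
    and add_closed: "x \<in> S \<Longrightarrow> y \<in> S \<Longrightarrow> x + y \<in> S"
    and mult_closed: "x \<in> S \<Longrightarrow> y \<in> S \<Longrightarrow> x * y \<in> S"
    and scal_closed: "x \<in> S \<Longrightarrow> scal c x \<in> S"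
    and star_closed: "x \<in> S \<Longrightarrow> star x \<in> S"
    and scal_add_right: "x \<in> S \<Longrightarrow> y \<in> S \<Longrightarrow> scal c (x + y) = scal c x + scal c y"
    and scal_add_left: "x \<in> S \<Longrightarrow> scal (c + d) x = scal c x + scal d x"
    and scal_scal: "x \<in> S \<Longrightarrow> scal c (scal d x) = scal (c * d) x"
    and scal_one: "x \<in> S \<Longrightarrow> scal 1 x = x"
    and scal_mult_left: "x \<in> S \<Longrightarrow> y \<in> S \<Longrightarrow> scal c x * y = scal c (x * y)"
    and scal_mult_right: "x \<in> S \<Longrightarrow> y \<in> S \<Longrightarrow> x * scal c y = scal c (x * y)"
    and star_add: "x \<in> S \<Longrightarrow> y \<in> S \<Longrightarrow> star (x + y) = star x + star y"
    and star_scal: "x \<in> S \<Longrightarrow> star (scal c x) = scal (cnj c) (star x)"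
    and star_mult: "x \<in> S \<Longrightarrow> y \<in> S \<Longrightarrow> star (x * y) = star y * star x"
    and star_star: "x \<in> S \<Longrightarrow> star (star x) = x"

locale complex_norm_on =
  fixes S :: "'b::ring set"
    and scal :: "complex \<Rightarrow> 'b \<Rightarrow> 'b"
    and nrm :: "'b \<Rightarrow> real"
  assumes nrm_nonneg: "x \<in> S \<Longrightarrow> 0 \<le> nrm x"
    and nrm_eq_zero_iff: "x \<in> S \<Longrightarrow> nrm x = 0 \<longleftrightarrow> x = 0"
    and nrm_scal: "x \<in> S \<Longrightarrow> nrm (scal c x) = cmod c * nrm x"
    and nrm_triangle: "x \<in> S \<Longrightarrow> y \<in> S \<Longrightarrow> nrm (x + y) \<le> nrm x + nrm y"

locale normed_star_algebra =
  complex_star_algebra S scal star + complex_norm_on S scal nrm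
  for S :: "'b::ring set"
    and scal :: "complex \<Rightarrow> 'b \<Rightarrow> 'b"
    and star :: "'b \<Rightarrow> 'b"
    and nrm :: "'b \<Rightarrow> real" +
  assumes nrm_mult: "x \<in> S \<Longrightarrow> y \<in> S \<Longrightarrow> nrm (x * y) \<le> nrm x * nrm y"

locale pre_cstar_algebra = normed_star_algebra +
  assumes cstar_identity: "x \<in> S \<Longrightarrow> nrm (star x * x) = (nrm x)\<^sup>2"

locale cstar_algebra = pre_cstar_algebra +
  assumes complete:
    "(\<And>n. X n \<in> S) \<Longrightarrow>
     (\<And>e. 0 < e \<Longrightarrow> \<exists>M. \<forall>m\<ge>M. \<forall>n\<ge>M. nrm (X m - X n) < e) \<Longrightarrow>
     \<exists>L\<in>S. (\<lambda>n. nrm (X n - L)) \<longlonglongrightarrow> 0"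

text \<open>
  The algebra \<open>\<A>[Z]\<close>. Its linear operations and its (Cauchy) product are those of type \<open>fps\<close>.
\<close>

definition abs_fps :: "'a::real_normed_algebra fps set" where
  "abs_fps = {F. summable (\<lambda>n. norm (fps_nth F n))}"

definition fps_scal :: "(complex \<Rightarrow> 'a \<Rightarrow> 'a) \<Rightarrow> complex \<Rightarrow> 'a fps \<Rightarrow> 'a::zero fps" where
  "fps_scal scal c F = Abs_fps (\<lambda>n. scal c (fps_nth F n))"

definition fps_star :: "('a \<Rightarrow> 'a) \<Rightarrow> 'a fps \<Rightarrow> 'a::zero fps" where
  "fps_star star F = Abs_fps (\<lambda>n. star (fps_nth F n))"

definition fps_term ::
    "(complex \<Rightarrow> 'a \<Rightarrow> 'a) \<Rightarrow> 'a::zero fps \<Rightarrow> real \<Rightarrow> nat \<Rightarrow> 'a" where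
  "fps_term scal F t n = scal (complex_of_real t ^ n) (fps_nth F n)"

definition fps_norm_on ::
    "(complex \<Rightarrow> 'a \<Rightarrow> 'a) \<Rightarrow> real set \<Rightarrow> 'a::real_normed_algebra fps \<Rightarrow> real" where
  "fps_norm_on scal K F = (SUP t\<in>K. norm (\<Sum>n. fps_term scal F t n))"

definition fps_l1_norm :: "'a::real_normed_algebra fps \<Rightarrow> real" where
  "fps_l1_norm F = (\<Sum>n. norm (fps_nth F n))"

end

theory Submission
  imports Defs
begin

text \<open>
  Every \<open>t \<in> [-1,1]\<close> gives an evaluation *-homomorphism \<open>\<A>[Z] \<rightarrow> \<A>\<close>, which is contractive for
  the \<open>\<ell>\<^sup>1\<close>-norm; the C*-identity and the other algebraic norm properties pass to the supremum.
  The norm is definite because a series vanishing at points \<open>t \<rightarrow> 0\<close>, \<open>t \<noteq> 0\<close>, has zero constant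
  coefficient, and one may then divide by \<open>Z\<close>. Completeness fails because the evaluation of an
  element of \<open>\<A>[Z]\<close> is Lipschitz at \<open>0\<close>, whereas the Weierstrass approximants of
  \<open>\<surd>\<bar>t\<bar>\<close>, multiplied by a fixed \<open>a \<noteq> 0\<close>, form a Cauchy sequence whose limit would have to take
  the values \<open>\<surd>\<bar>t\<bar> a\<close>.
\<close>

text \<open>By additivity, continuity at 0 gives continuity everywhere, and the bound gives
  continuity at 0. Real linearity is avoided because no axiom ties \<open>scal\<close> to the real
  scalar multiplication of the type; the lemma is meant for \<open>scal c\<close> and
  \<open>star\<close>.\<close>

lemma sums_additive_bounded:
  fixes h :: "'a::real_normed_vector \<Rightarrow> 'b::real_normed_vector"
  assumes add: "\<And>x y. h (x + y) = h x + h y"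
    and bound: "\<And>x. norm (h x) \<le> C * norm x"
    and "f sums s"
  shows "(\<lambda>n. h (f n)) sums h s"
proof -
  interpret Modules.additive h by unfold_locales (rule add)
  have "(\<lambda>n. (\<Sum>i<n. f i) - s) \<longlonglongrightarrow> 0"
    using \<open>f sums s\<close> by (simp add: sums_def LIM_zero)
  then have "(\<lambda>n. C * norm ((\<Sum>i<n. f i) - s)) \<longlonglongrightarrow> 0"
    by (intro tendsto_mult_right_zero tendsto_norm_zero)
  then have "(\<lambda>n. h ((\<Sum>i<n. f i) - s)) \<longlonglongrightarrow> 0"
    by (rule Lim_null_comparison[rotated]) (simp add: bound)
  then show ?thesis
    unfolding sums_def diff by (auto simp: sum intro: LIM_zero_cancel)
qed

section \<open>Closure properties of \<open>abs_fps\<close> and truncation in the l1-norm\<close>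

lemma abs_fpsD: "F \<in> abs_fps \<Longrightarrow> summable (\<lambda>n. norm (fps_nth F n))"
  by (simp add: abs_fps_def)

lemma abs_fps_zero: "0 \<in> abs_fps"
  by (simp add: abs_fps_def)

lemma abs_fps_add:
  assumes "F \<in> abs_fps" "G \<in> abs_fps"
  shows "F + G \<in> abs_fps"
  unfolding abs_fps_def mem_Collect_eq
  by (rule summable_comparison_test'[OF summable_add[OF assms[THEN abs_fpsD]], of 0])
    (simp add: norm_triangle_ineq)

lemma abs_fps_diff:
  assumes "F \<in> abs_fps" "G \<in> abs_fps"
  shows "F - G \<in> abs_fps"
  unfolding abs_fps_def mem_Collect_eq
  by (rule summable_comparison_test'[OF summable_add[OF assms[THEN abs_fpsD]], of 0])
    (simp add: norm_triangle_ineq4)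

lemma abs_fps_mult:
  fixes F G :: "'a::real_normed_algebra fps"
  assumes "F \<in> abs_fps" "G \<in> abs_fps"
  shows "F * G \<in> abs_fps"
  unfolding abs_fps_def mem_Collect_eq
proof (rule summable_comparison_test')
  show "summable (\<lambda>n. \<Sum>i\<le>n. norm (fps_nth F i) * norm (fps_nth G (n - i)))"
    using assms[THEN abs_fpsD] by (intro summable_Cauchy_product) simp_all
  show "norm (norm (fps_nth (F * G) n)) \<le> (\<Sum>i\<le>n. norm (fps_nth F i) * norm (fps_nth G (n - i)))"
    for n
    by (auto simp: fps_mult_nth atLeast0AtMost intro!: sum_norm_le norm_mult_ineq)
qed

lemma abs_fps_finite_support:
  assumes "\<And>n. n \<ge> N \<Longrightarrow> fps_nth F n = 0"
  shows "F \<in> abs_fps"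
  unfolding abs_fps_def mem_Collect_eq
  by (rule summable_finite[of "{..<N}"]) (use assms in \<open>auto simp: not_less\<close>)

lemma abs_fps_shift: "F \<in> abs_fps \<Longrightarrow> fps_shift k F \<in> abs_fps"
  unfolding abs_fps_def mem_Collect_eq fps_shift_nth by (rule summable_ignore_initial_segment)

lemma fps_l1_norm_nonneg: "F \<in> abs_fps \<Longrightarrow> 0 \<le> fps_l1_norm F"
  unfolding fps_l1_norm_def by (intro suminf_nonneg abs_fpsD) auto

text \<open>The values are tails of the convergent series of coefficient norms. Since
  \<open>fps_cutoff N\<close> keeps only the coefficients of index below N, the partial sum up to
  and including N is the cutoff at \<open>Suc N\<close>.\<close>

lemma fps_l1_norm_cutoff_tendsto:
  fixes F :: "'a::real_normed_algebra fps"
  assumes "F \<in> abs_fps"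
  shows "(\<lambda>N. fps_l1_norm (fps_cutoff (Suc N) F - F)) \<longlonglongrightarrow> 0"
proof -
  note sm = abs_fpsD[OF assms]
  have eq: "fps_l1_norm (fps_cutoff N F - F) = (\<Sum>n. norm (fps_nth F n)) - (\<Sum>n<N. norm (fps_nth F n))"
    for N
  proof -
    have "(\<lambda>n. norm (fps_nth (fps_cutoff N F - F) n)) =
        (\<lambda>n. norm (fps_nth F n) - (if n < N then norm (fps_nth F n) else 0))"
      by auto
    moreover have "(\<lambda>n. if n < N then norm (fps_nth F n) else 0) sums (\<Sum>n<N. norm (fps_nth F n))"
      using sums_If_finite_set[of "{..<N}" "\<lambda>n. norm (fps_nth F n)"] by simp
    ultimately show ?thesis
      unfolding fps_l1_norm_def
      using sums_unique[OF sums_diff[OF summable_sums[OF sm]]] by metis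
  qed
  have "(\<lambda>N. \<Sum>n<N. norm (fps_nth F n)) \<longlonglongrightarrow> (\<Sum>n. norm (fps_nth F n))"
    by (rule summable_LIMSEQ[OF sm])
  from LIMSEQ_Suc[OF this] show ?thesis
    unfolding eq by (intro tendsto_eq_intros) (auto intro: tendsto_eq_intros)
qed

text \<open>The C*-norm is the norm of the type itself, so that the general theory of series and
  Cauchy products applies; complex scalars and involution stay explicit.\<close>

locale cstar_series = cstar_algebra "UNIV :: 'a set" scal star norm
  for scal :: "complex \<Rightarrow> 'a \<Rightarrow> 'a::{real_normed_algebra, banach}"
    and star :: "'a \<Rightarrow> 'a" +
  fixes K :: "real set"
  assumes K_subset: "K \<subseteq> {-1..1}" and K_limpt: "0 islimpt K"
begin

lemma norm_scal: "norm (scal c x) = cmod c * norm x"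
  by (rule nrm_scal) simp

text \<open>The C*-identity and submultiplicativity bound the square of \<open>norm x\<close> by
  \<open>norm (star x) * norm x\<close>. Cancelling gives one inequality, and replacing x by
  \<open>star x\<close> gives the other.\<close>

lemma norm_star: "norm (star x) = norm x"
proof -
  have le: "norm x \<le> norm (star x)" for x
  proof (cases "x = 0")
    case False
    have "norm x * norm x = norm (star x * x)"
      using cstar_identity[of x] by (simp add: power2_eq_square)
    also have "\<dots> \<le> norm (star x) * norm x"
      by (rule norm_mult_ineq)
    finally show ?thesis using False by simp
  qed simp
  show ?thesis using le[of x] le[of "star x"] star_star[of x] by simp
qed

lemma additive_scal: "Modules.additive (scal c)"
  by unfold_locales (simp add: scal_add_right)

lemma sums_scal: "f sums s \<Longrightarrow> (\<lambda>n. scal c (f n)) sums scal c s"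
  by (rule sums_additive_bounded[where C = "cmod c"]) (simp_all add: scal_add_right norm_scal)

lemma sums_star: "f sums s \<Longrightarrow> (\<lambda>n. star (f n)) sums star s"
  by (rule sums_additive_bounded[where C = 1]) (simp_all add: star_add norm_star)

lemma K_abs: "t \<in> K \<Longrightarrow> \<bar>t\<bar> \<le> 1"
  using subsetD[OF K_subset, of t] by (simp add: abs_le_iff)

lemma K_nonempty: "K \<noteq> {}"
  using K_limpt by auto

lemma K_small:
  assumes "e > 0"
  obtains t where "t \<in> K" "t \<noteq> 0" "\<bar>t\<bar> < e"
  using K_limpt assms unfolding islimpt_approachable dist_real_def by auto

section \<open>Evaluation at a point of [-1,1] as a contractive *-homomorphism\<close>

abbreviation ev :: "real \<Rightarrow> 'a fps \<Rightarrow> 'a" where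
  "ev t F \<equiv> \<Sum>n. fps_term scal F t n"

lemma norm_fps_term_le: "\<bar>t\<bar> \<le> 1 \<Longrightarrow> norm (fps_term scal F t n) \<le> norm (fps_nth F n)"
  unfolding fps_term_def norm_scal norm_power norm_of_real
  by (intro mult_left_le_one_le) (auto intro: power_le_one)

lemma summable_norm_fps_term:
  assumes "F \<in> abs_fps" "\<bar>t\<bar> \<le> 1"
  shows "summable (\<lambda>n. norm (fps_term scal F t n))"
  by (rule summable_comparison_test'[OF abs_fpsD[OF assms(1)], of 0])
    (simp add: norm_fps_term_le assms(2))

lemma sums_ev: "F \<in> abs_fps \<Longrightarrow> \<bar>t\<bar> \<le> 1 \<Longrightarrow> fps_term scal F t sums ev t F"
  by (rule summable_sums[OF summable_norm_cancel[OF summable_norm_fps_term]])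

lemma norm_ev_le_l1:
  assumes "F \<in> abs_fps" "\<bar>t\<bar> \<le> 1"
  shows "norm (ev t F) \<le> fps_l1_norm F"
proof -
  have "norm (ev t F) \<le> (\<Sum>n. norm (fps_term scal F t n))"
    by (rule summable_norm[OF summable_norm_fps_term[OF assms]])
  also have "\<dots> \<le> fps_l1_norm F"
    unfolding fps_l1_norm_def
    by (intro suminf_le summable_norm_fps_term abs_fpsD norm_fps_term_le assms)
  finally show ?thesis .
qed

lemma ev_add:
  assumes "F \<in> abs_fps" "G \<in> abs_fps" "\<bar>t\<bar> \<le> 1"
  shows "ev t (F + G) = ev t F + ev t G"
  using sums_unique[OF sums_add[OF sums_ev[OF assms(1,3)] sums_ev[OF assms(2,3)]]]
  by (simp add: fps_term_def[abs_def] scal_add_right)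

lemma ev_diff:
  assumes "F \<in> abs_fps" "G \<in> abs_fps" "\<bar>t\<bar> \<le> 1"
  shows "ev t (F - G) = ev t F - ev t G"
  using sums_unique[OF sums_diff[OF sums_ev[OF assms(1,3)] sums_ev[OF assms(2,3)]]]
  by (simp add: fps_term_def[abs_def] Modules.additive.diff[OF additive_scal])

lemma ev_scal:
  assumes "F \<in> abs_fps" "\<bar>t\<bar> \<le> 1"
  shows "ev t (fps_scal scal c F) = scal c (ev t F)"
  using sums_unique[OF sums_scal[OF sums_ev[OF assms], of c]]
  by (simp add: fps_term_def[abs_def] fps_scal_def scal_scal mult.commute)

lemma ev_star:
  assumes "F \<in> abs_fps" "\<bar>t\<bar> \<le> 1"
  shows "ev t (fps_star star F) = star (ev t F)"
  using sums_unique[OF sums_star[OF sums_ev[OF assms]]]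
  by (simp add: fps_term_def[abs_def] fps_star_def star_scal)

text \<open>The powers with exponents i and n - i combine to exponent n, so evaluation turns the
  convolution of coefficients into the convolution of evaluated terms. This is the form in which the
  Cauchy product theorem yields multiplicativity.\<close>

lemma fps_term_mult:
  "fps_term scal (F * G) t n = (\<Sum>i\<le>n. fps_term scal F t i * fps_term scal G t (n - i))"
proof -
  have "fps_term scal F t i * fps_term scal G t (n - i) =
      scal (of_real t ^ n) (fps_nth F i * fps_nth G (n - i))" if "i \<le> n" for i
    using that
    by (simp add: fps_term_def scal_mult_left scal_mult_right scal_scal power_add[symmetric])
  then show ?thesis
    by (simp add: fps_term_def[of scal "F * G"] fps_mult_nth atLeast0AtMost
        Modules.additive.sum[OF additive_scal])
qed

lemma ev_mult:
  assumes "F \<in> abs_fps" "G \<in> abs_fps" "\<bar>t\<bar> \<le> 1"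
  shows "ev t (F * G) = ev t F * ev t G"
  unfolding fps_term_mult
  by (intro Cauchy_product[symmetric] summable_norm_fps_term assms)

text \<open>Splitting off one factor t serves twice: it gives the Lipschitz estimate at 0, and it is
  the division by Z in the induction on coefficients.\<close>

lemma ev_shift:
  assumes "F \<in> abs_fps" "\<bar>t\<bar> \<le> 1"
  shows "ev t F = fps_nth F 0 + scal (of_real t) (ev t (fps_shift 1 F))"
proof -
  have "scal (of_real t) (ev t (fps_shift 1 F)) = (\<Sum>n. fps_term scal F t (Suc n))"
    using sums_unique[OF sums_scal[OF sums_ev[OF abs_fps_shift[OF assms(1), of 1] assms(2)]]]
    by (simp add: fps_term_def[abs_def] scal_scal)
  also have "\<dots> = ev t F - fps_term scal F t 0"
    using sums_ev[OF assms] by (intro suminf_split_head) (rule sums_summable)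
  finally show ?thesis by (simp add: fps_term_def scal_one)
qed

lemma norm_ev_diff_le:
  assumes "F \<in> abs_fps" "\<bar>t\<bar> \<le> 1"
  shows "norm (ev t F - fps_nth F 0) \<le> \<bar>t\<bar> * fps_l1_norm (fps_shift 1 F)"
  unfolding ev_shift[OF assms]
  by (simp add: norm_scal mult_left_mono norm_ev_le_l1 abs_fps_shift assms)

section \<open>Uniqueness of coefficients from values near 0\<close>

lemma fps_nth_0_eq_zero:
  assumes F: "F \<in> abs_fps"
    and small: "\<And>e. e > 0 \<Longrightarrow> \<exists>d>0. \<forall>t\<in>K - {0}. \<bar>t\<bar> < d \<longrightarrow> norm (ev t F) \<le> e"
  shows "fps_nth F 0 = 0"
proof (rule ccontr)
  define C where "C = fps_l1_norm (fps_shift 1 F)"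
  have "C \<ge> 0" unfolding C_def by (intro fps_l1_norm_nonneg abs_fps_shift F)
  assume "fps_nth F 0 \<noteq> 0"
  define e where "e = norm (fps_nth F 0)"
  have "e > 0" using \<open>fps_nth F 0 \<noteq> 0\<close> by (simp add: e_def)
  then obtain d where d: "d > 0" "\<And>t. t \<in> K - {0} \<Longrightarrow> \<bar>t\<bar> < d \<Longrightarrow> norm (ev t F) \<le> e / 2"
    using small[of "e / 2"] by auto
  \<comment> \<open>The second bound makes the Lipschitz error \<open>\<bar>t\<bar> * C\<close>
    smaller than e/2, which forces e < e. Using C + 1 keeps the denominator positive when C =
    0.\<close>
  have "min d (e / (2 * (C + 1))) > 0"
    using d(1) \<open>e > 0\<close> \<open>C \<ge> 0\<close> by simp
  then obtain t where t: "t \<in> K" "t \<noteq> 0" "\<bar>t\<bar> < d" "\<bar>t\<bar> < e / (2 * (C + 1))"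
    by (rule K_small) auto
  have "e \<le> norm (ev t F) + norm (ev t F - fps_nth F 0)"
    unfolding e_def using norm_triangle_sub[of "fps_nth F 0" "ev t F"]
    by (simp add: norm_minus_commute)
  also have "\<dots> \<le> e / 2 + \<bar>t\<bar> * C"
    using d(2)[of t] norm_ev_diff_le[OF F K_abs[OF t(1)]] t by (auto simp: C_def intro!: add_mono)
  also have "\<bar>t\<bar> * C \<le> \<bar>t\<bar> * (C + 1)"
    by (simp add: mult_left_mono)
  also have "\<bar>t\<bar> * (C + 1) < e / 2"
    using t(4) \<open>C \<ge> 0\<close> by (simp add: field_simps)
  finally show False by simp
qed

text \<open>Once the constant coefficient vanishes, F is Z times its shift, and t cancels at every
  nonzero t in K. The cancellation gives nothing at t = 0, so the hypothesis carried through the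
  induction leaves that point out.\<close>

lemma fps_nth_eq_zero:
  assumes "F \<in> abs_fps" "\<And>t. t \<in> K - {0} \<Longrightarrow> ev t F = 0"
  shows "fps_nth F n = 0"
  using assms
proof (induction n arbitrary: F)
  case 0
  then show ?case by (intro fps_nth_0_eq_zero) (auto intro: exI[of _ 1])
next
  case (Suc n)
  have "fps_nth F 0 = 0"
    using Suc.prems by (intro fps_nth_0_eq_zero) (auto intro: exI[of _ 1])
  have "ev t (fps_shift 1 F) = 0" if "t \<in> K - {0}" for t
  proof -
    have "scal (of_real t) (ev t (fps_shift 1 F)) = 0"
      using ev_shift[OF Suc.prems(1), of t] Suc.prems(2)[OF that] K_abs[of t] that
        \<open>fps_nth F 0 = 0\<close> by simp
    then have "cmod (of_real t) * norm (ev t (fps_shift 1 F)) = 0"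
      by (metis norm_scal norm_zero)
    then show ?thesis using that by simp
  qed
  from Suc.IH[OF abs_fps_shift[OF Suc.prems(1)] this] show ?case by simp
qed

section \<open>The supremum norm and the pre-C*-algebra structure\<close>

lemma bdd_above_ev: "F \<in> abs_fps \<Longrightarrow> bdd_above ((\<lambda>t. norm (ev t F)) ` K)"
  by (rule bdd_aboveI[of _ "fps_l1_norm F"]) (auto intro!: norm_ev_le_l1 K_abs)

lemma norm_ev_le: "F \<in> abs_fps \<Longrightarrow> t \<in> K \<Longrightarrow> norm (ev t F) \<le> fps_norm_on scal K F"
  unfolding fps_norm_on_def by (rule cSUP_upper[OF _ bdd_above_ev])

lemma fps_norm_on_le: "(\<And>t. t \<in> K \<Longrightarrow> norm (ev t F) \<le> B) \<Longrightarrow> fps_norm_on scal K F \<le> B"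
  unfolding fps_norm_on_def by (rule cSUP_least[OF K_nonempty])

lemma fps_norm_on_nonneg: "F \<in> abs_fps \<Longrightarrow> 0 \<le> fps_norm_on scal K F"
  using K_nonempty order_trans[OF norm_ge_zero norm_ev_le] by auto

lemma fps_norm_on_le_l1: "F \<in> abs_fps \<Longrightarrow> fps_norm_on scal K F \<le> fps_l1_norm F"
  by (intro fps_norm_on_le norm_ev_le_l1 K_abs)

lemma abs_fps_scal: "F \<in> abs_fps \<Longrightarrow> fps_scal scal c F \<in> abs_fps"
  by (simp add: abs_fps_def fps_scal_def norm_scal summable_mult)

lemma abs_fps_star: "F \<in> abs_fps \<Longrightarrow> fps_star star F \<in> abs_fps"
  by (simp add: abs_fps_def fps_star_def norm_star)

text \<open>One inequality suffices: for c nonzero, applying it to \<open>inverse c\<close> and the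
  scaled series gives the reverse one.\<close>

lemma fps_norm_on_scal_le:
  assumes "F \<in> abs_fps"
  shows "fps_norm_on scal K (fps_scal scal c F) \<le> cmod c * fps_norm_on scal K F"
  by (rule fps_norm_on_le)
    (simp add: ev_scal assms K_abs norm_scal mult_left_mono norm_ev_le)

lemma complex_norm_on_abs_fps: "complex_norm_on abs_fps (fps_scal scal) (fps_norm_on scal K)"
proof
  fix F G :: "'a fps" and c
  assume F: "F \<in> abs_fps"
  show "0 \<le> fps_norm_on scal K F" by (rule fps_norm_on_nonneg[OF F])
  show "fps_norm_on scal K F = 0 \<longleftrightarrow> F = 0"
  proof
    assume "fps_norm_on scal K F = 0"
    then have "ev t F = 0" if "t \<in> K" for t
      using norm_ev_le[OF F that] by simp
    then have "fps_nth F n = 0" for n by (intro fps_nth_eq_zero[OF F]) simp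
    then show "F = 0" by (intro fps_ext) simp
  next
    assume "F = 0"
    have "fps_norm_on scal K F \<le> fps_l1_norm F" by (rule fps_norm_on_le_l1[OF F])
    also have "\<dots> = 0" by (simp add: \<open>F = 0\<close> fps_l1_norm_def)
    finally show "fps_norm_on scal K F = 0" using fps_norm_on_nonneg[OF F] by simp
  qed
  show "fps_norm_on scal K (fps_scal scal c F) = cmod c * fps_norm_on scal K F"
  proof (rule antisym[OF fps_norm_on_scal_le[OF F]], cases "c = 0")
    case True
    then show "cmod c * fps_norm_on scal K F \<le> fps_norm_on scal K (fps_scal scal c F)"
      using fps_norm_on_nonneg[OF abs_fps_scal[OF F]] by simp
  next
    case False
    have "fps_scal scal (inverse c) (fps_scal scal c F) = F"
      using False by (intro fps_ext) (simp add: fps_scal_def scal_scal scal_one)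
    then have "fps_norm_on scal K F \<le> cmod (inverse c) * fps_norm_on scal K (fps_scal scal c F)"
      using fps_norm_on_scal_le[OF abs_fps_scal[OF F], of "inverse c" c] by simp
    then show "cmod c * fps_norm_on scal K F \<le> fps_norm_on scal K (fps_scal scal c F)"
      using False by (simp add: norm_divide field_simps)
  qed
  assume G: "G \<in> abs_fps"
  show "fps_norm_on scal K (F + G) \<le> fps_norm_on scal K F + fps_norm_on scal K G"
    by (rule fps_norm_on_le)
      (auto simp: ev_add F G K_abs intro!: norm_triangle_le add_mono norm_ev_le)
qed

lemma complex_star_algebra_abs_fps:
  "complex_star_algebra abs_fps (fps_scal scal) (fps_star star)"
proof
  fix F G :: "'a fps"
  have "Modules.additive star" by unfold_locales (simp add: star_add)
  \<comment> \<open>The involution reverses each product, so the summation index must be reflected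
    to recover the Cauchy product of the starred series in the opposite order.\<close>
  have "(\<Sum>i\<le>n. star (fps_nth G (n - i)) * star (fps_nth F i)) =
      (\<Sum>i\<le>n. star (fps_nth G i) * star (fps_nth F (n - i)))" for n
    by (rule sum.reindex_bij_witness[of _ "\<lambda>i. n - i" "\<lambda>i. n - i"]) auto
  then show "fps_star star (F * G) = fps_star star G * fps_star star F"
    by (intro fps_ext)
      (simp add: fps_star_def fps_mult_nth Modules.additive.sum[OF \<open>Modules.additive star\<close>] star_mult atLeast0AtMost)
  show "fps_scal scal c F * G = fps_scal scal c (F * G)"
    "F * fps_scal scal c G = fps_scal scal c (F * G)" for c
    by (auto intro!: fps_ext sum.cong simp: fps_scal_def fps_mult_nth Modules.additive.sum[OF additive_scal]
        scal_mult_left scal_mult_right)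
qed (auto intro!: abs_fps_zero abs_fps_add abs_fps_mult
    abs_fps_scal[unfolded fps_scal_def] abs_fps_star[unfolded fps_star_def] fps_ext
    simp: fps_scal_def fps_star_def scal_add_right scal_add_left scal_scal scal_one
      star_add star_scal star_star)

lemma pre_cstar_algebra_abs_fps:
  "pre_cstar_algebra abs_fps (fps_scal scal) (fps_star star) (fps_norm_on scal K)"
proof -
  interpret A: complex_star_algebra abs_fps "fps_scal scal" "fps_star star"
    by (rule complex_star_algebra_abs_fps)
  interpret N: complex_norm_on abs_fps "fps_scal scal" "fps_norm_on scal K"
    by (rule complex_norm_on_abs_fps)
  show ?thesis
  proof
    fix F G :: "'a fps"
    assume F: "F \<in> abs_fps"
    have ev_sq: "norm (ev t (fps_star star F * F)) = (norm (ev t F))\<^sup>2" if "t \<in> K" for t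
      using that by (simp add: ev_mult ev_star abs_fps_star F K_abs cstar_identity)
    let ?S = "fps_norm_on scal K (fps_star star F * F)"
    \<comment> \<open>The pointwise C*-identity is used in square-root form, so that the supremum
      over t can be taken before squaring.\<close>
    have "norm (ev t F) \<le> sqrt ?S" if "t \<in> K" for t
      using norm_ev_le[OF abs_fps_mult[OF abs_fps_star[OF F] F] that]
      by (intro real_le_rsqrt) (simp add: ev_sq[OF that])
    then have "(fps_norm_on scal K F)\<^sup>2 \<le> (sqrt ?S)\<^sup>2"
      by (intro power_mono fps_norm_on_nonneg[OF F] fps_norm_on_le)
    also have "\<dots> = ?S"
      by (simp add: fps_norm_on_nonneg abs_fps_mult abs_fps_star F)
    finally have "(fps_norm_on scal K F)\<^sup>2 \<le> ?S" .
    moreover have "?S \<le> (fps_norm_on scal K F)\<^sup>2"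
      by (rule fps_norm_on_le) (simp add: ev_sq power_mono norm_ev_le F)
    ultimately show "?S = (fps_norm_on scal K F)\<^sup>2" by simp
    assume G: "G \<in> abs_fps"
    show "fps_norm_on scal K (F * G) \<le> fps_norm_on scal K F * fps_norm_on scal K G"
    proof (rule fps_norm_on_le)
      fix t assume "t \<in> K"
      have "norm (ev t F * ev t G) \<le> norm (ev t F) * norm (ev t G)"
        by (rule norm_mult_ineq)
      also have "\<dots> \<le> fps_norm_on scal K F * fps_norm_on scal K G"
        by (intro mult_mono norm_ev_le F G \<open>t \<in> K\<close> fps_norm_on_nonneg) auto
      finally show "norm (ev t (F * G)) \<le> fps_norm_on scal K F * fps_norm_on scal K G"
        by (simp add: ev_mult F G K_abs \<open>t \<in> K\<close>)
    qed
  qed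
qed

section \<open>Failure of completeness over a nonzero algebra\<close>

lemma continuous_approx_by_series:
  assumes "continuous_on {-1..1} f" "e > 0"
  obtains F where "F \<in> abs_fps"
    "\<And>t. t \<in> K \<Longrightarrow> norm (ev t F - scal (of_real (f t)) a) \<le> e * norm a"
proof -
  obtain g :: "real \<Rightarrow> real" where "real_polynomial_function g"
    and g: "\<And>x. x \<in> {-1..1} \<Longrightarrow> \<bar>f x - g x\<bar> < e"
    using Stone_Weierstrass_real_polynomial_function[OF compact_Icc assms] by blast
  then obtain c m where gc: "g = (\<lambda>x. \<Sum>i\<le>m. c i * x ^ i)"
    unfolding real_polynomial_function_iff_sum by blast
  \<comment> \<open>F is the approximating polynomial g times the fixed element a, so its value at t
    is g(t)a; this is why the error bound acquires the factor \<open>norm a\<close>.\<close>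
  define F where "F = Abs_fps (\<lambda>i. if i \<le> m then scal (of_real (c i)) a else 0)"
  have scal_zero: "scal z 0 = 0" for z using norm_scal[of z 0] by simp
  have add_left: "Modules.additive (\<lambda>z. scal z a)"
    by unfold_locales (simp add: scal_add_left)
  have "F \<in> abs_fps"
    by (rule abs_fps_finite_support[of "Suc m"]) (simp add: F_def)
  moreover have "norm (ev t F - scal (of_real (f t)) a) \<le> e * norm a" if "t \<in> K" for t
  proof -
    have "ev t F = (\<Sum>i\<le>m. fps_term scal F t i)"
      by (rule suminf_finite) (auto simp: fps_term_def F_def scal_zero)
    also have "\<dots> = (\<Sum>i\<le>m. scal (of_real (c i * t ^ i)) a)"
      by (rule sum.cong) (simp_all add: fps_term_def F_def scal_scal mult.commute)
    also have "\<dots> = scal (of_real (g t)) a"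
      by (simp only: gc of_real_sum Modules.additive.sum[OF add_left])
    finally have "ev t F - scal (of_real (f t)) a = scal (of_real (g t) - of_real (f t)) a"
      by (simp add: Modules.additive.diff[OF add_left])
    also have "norm \<dots> = \<bar>f t - g t\<bar> * norm a"
      by (simp add: norm_scal abs_minus_commute flip: of_real_diff)
    also have "\<dots> \<le> e * norm a"
      using g[of t] K_subset that by (intro mult_right_mono) auto
    finally show ?thesis .
  qed
  ultimately show ?thesis by (rule that)
qed

lemma not_cstar_algebra_abs_fps:
  assumes "a \<noteq> (0::'a)"
  shows "\<not> cstar_algebra abs_fps (fps_scal scal) (fps_star star) (fps_norm_on scal K)"
proof
  assume "cstar_algebra abs_fps (fps_scal scal) (fps_star star) (fps_norm_on scal K)"
  then interpret C: cstar_algebra abs_fps "fps_scal scal" "fps_star star" "fps_norm_on scal K" .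
  \<comment> \<open>The intended limit: b tends to 0 at 0, but its norm divided by
    \<open>\<bar>t\<bar>\<close> is unbounded there, which no Lipschitz bound at 0 permits.\<close>
  define b where "b t = scal (of_real (sqrt \<bar>t\<bar>)) a" for t
  have norm_b: "norm (b t) = sqrt \<bar>t\<bar> * norm a" for t
    by (simp add: b_def norm_scal)
  have cont: "continuous_on {-1..1} (\<lambda>t::real. sqrt \<bar>t\<bar>)"
    by (intro continuous_intros)
  have "\<exists>F. F \<in> abs_fps \<and>
      (\<forall>t\<in>K. norm (ev t F - b t) \<le> inverse (real (Suc n)) * norm a)" for n
    using continuous_approx_by_series[OF cont, of "inverse (real (Suc n))" a]
    unfolding b_def by (metis inverse_positive_iff_positive of_nat_0_less_iff zero_less_Suc)
  then obtain X where X: "\<And>n. X n \<in> abs_fps"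
    and Xb: "\<And>n t. t \<in> K \<Longrightarrow> norm (ev t (X n) - b t) \<le> inverse (real (Suc n)) * norm a"
    by metis
  \<comment> \<open>r n bounds the uniform distance on K between b and the values of X n. Comparing
    through b shows that X is Cauchy, although b is not assumed to come from a series.\<close>
  define r where "r n = inverse (real (Suc n)) * norm a" for n
  have "r \<longlonglongrightarrow> 0"
    unfolding r_def by (rule tendsto_mult_left_zero[OF LIMSEQ_inverse_real_of_nat])
  have diff_le: "fps_norm_on scal K (X m - X n) \<le> r m + r n" for m n
  proof (rule fps_norm_on_le)
    fix t assume "t \<in> K"
    have "norm (ev t (X m) - ev t (X n)) \<le> norm (ev t (X m) - b t) + norm (ev t (X n) - b t)"
      using norm_triangle_ineq4[of "ev t (X m) - b t" "ev t (X n) - b t"] by simp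
    also have "\<dots> \<le> r m + r n"
      unfolding r_def by (intro add_mono Xb \<open>t \<in> K\<close>)
    finally show "norm (ev t (X m - X n)) \<le> r m + r n"
      by (simp add: ev_diff X K_abs \<open>t \<in> K\<close>)
  qed
  have "\<exists>M. \<forall>m\<ge>M. \<forall>n\<ge>M. fps_norm_on scal K (X m - X n) < e" if "e > 0" for e
  proof -
    have "eventually (\<lambda>n. r n < e / 2) sequentially"
      using order_tendstoD(2)[OF \<open>r \<longlonglongrightarrow> 0\<close>, of "e / 2"] that by simp
    then obtain M where M: "\<And>n. n \<ge> M \<Longrightarrow> r n < e / 2"
      by (auto simp: eventually_sequentially)
    have "fps_norm_on scal K (X m - X n) < e" if "m \<ge> M" "n \<ge> M" for m n
      using diff_le[of m n] M[OF that(1)] M[OF that(2)] by linarith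
    then show ?thesis by blast
  qed
  with C.complete[of X] X obtain L where L: "L \<in> abs_fps"
    and lim: "(\<lambda>n. fps_norm_on scal K (X n - L)) \<longlonglongrightarrow> 0"
    by blast
  have ev_L: "ev t L = b t" if "t \<in> K" for t
  proof -
    have "norm (ev t L - b t) \<le> fps_norm_on scal K (X n - L) + r n" for n
    proof -
      have "norm (ev t L - b t) \<le> norm (ev t (X n) - ev t L) + norm (ev t (X n) - b t)"
        using norm_triangle_ineq4[of "ev t (X n) - b t" "ev t (X n) - ev t L"] by simp
      also have "\<dots> \<le> fps_norm_on scal K (X n - L) + r n"
        using norm_ev_le[OF abs_fps_diff[OF X L] that, of n] Xb[OF that, of n]
        by (simp add: r_def ev_diff X L K_abs that)
      finally show ?thesis .
    qed
    moreover have "(\<lambda>n. fps_norm_on scal K (X n - L) + r n) \<longlonglongrightarrow> 0"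
      using tendsto_add[OF lim \<open>r \<longlonglongrightarrow> 0\<close>] by simp
    ultimately have "norm (ev t L - b t) \<le> 0"
      by (intro LIMSEQ_le_const) auto
    then show ?thesis by simp
  qed
  \<comment> \<open>As 0 need not belong to K, the constant coefficient is found from nearby values.
    The radius below is the solution of \<open>sqrt \<bar>t\<bar> * norm a = e\<close> for
    \<open>\<bar>t\<bar>\<close>.\<close>
  have "fps_nth L 0 = 0"
  proof (rule fps_nth_0_eq_zero[OF L])
    fix e :: real assume "e > 0"
    have "sqrt \<bar>t\<bar> * norm a \<le> e" if "\<bar>t\<bar> < (e / norm a)\<^sup>2" for t
    proof -
      have "sqrt \<bar>t\<bar> \<le> e / norm a"
        using that \<open>e > 0\<close> by (intro real_le_lsqrt) auto
      then show ?thesis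
        using assms by (simp add: pos_le_divide_eq)
    qed
    then show "\<exists>d>0. \<forall>t\<in>K - {0}. \<bar>t\<bar> < d \<longrightarrow> norm (ev t L) \<le> e"
      using \<open>e > 0\<close> assms by (intro exI[of _ "(e / norm a)\<^sup>2"]) (auto simp: ev_L norm_b)
  qed
  define C where "C = fps_l1_norm (fps_shift 1 L)"
  have "C \<ge> 0" unfolding C_def by (intro fps_l1_norm_nonneg abs_fps_shift L)
  \<comment> \<open>The Lipschitz bound for L, divided by \<open>sqrt \<bar>t\<bar>\<close>, reads
    \<open>norm a \<le> sqrt \<bar>t\<bar> * C\<close>; this choice of t makes even
    \<open>sqrt \<bar>t\<bar> * (C + 1)\<close> smaller than \<open>norm a\<close>.\<close>
  obtain t where t: "t \<in> K" "t \<noteq> 0" "\<bar>t\<bar> < (norm a / (C + 1))\<^sup>2"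
    using K_small[of "(norm a / (C + 1))\<^sup>2"] assms \<open>C \<ge> 0\<close> by auto
  have "sqrt \<bar>t\<bar> * norm a \<le> \<bar>t\<bar> * C"
    using norm_ev_diff_le[OF L K_abs[OF t(1)]] \<open>fps_nth L 0 = 0\<close>
    by (simp add: ev_L t(1) norm_b C_def)
  also have "\<dots> = sqrt \<bar>t\<bar> * (sqrt \<bar>t\<bar> * C)"
    by (simp flip: mult.assoc)
  finally have "norm a \<le> sqrt \<bar>t\<bar> * C"
    using t(2) by simp
  also have "\<dots> \<le> sqrt \<bar>t\<bar> * (C + 1)"
    by (simp add: mult_left_mono)
  also have "\<dots> < norm a"
  proof -
    have "sqrt \<bar>t\<bar> < norm a / (C + 1)"
      using t(3) \<open>C \<ge> 0\<close> by (intro real_less_lsqrt) auto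
    then show ?thesis using \<open>C \<ge> 0\<close> by (simp add: pos_less_divide_eq)
  qed
  finally show False by simp
qed

section \<open>Convergence of truncations and the full statement\<close>

lemma fps_norm_on_cutoff_tendsto:
  assumes "F \<in> abs_fps"
  shows "(\<lambda>N. fps_norm_on scal K (fps_cutoff (Suc N) F - F)) \<longlonglongrightarrow> 0"
proof -
  have mem: "fps_cutoff N F - F \<in> abs_fps" for N
    by (intro abs_fps_diff assms abs_fps_finite_support[of N]) simp
  show ?thesis
    by (rule tendsto_sandwich[OF _ _ tendsto_const fps_l1_norm_cutoff_tendsto[OF assms]])
      (simp_all add: fps_norm_on_nonneg fps_norm_on_le_l1 mem)
qed

end

text \<open>Infinite sums and suprema are total functions with default values, so convergence of the
  evaluations and boundedness over K are asserted alongside the norm axioms. Incompleteness is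
  claimed when some a is nonzero: over the zero algebra, \<open>abs_fps\<close> contains only 0 and
  is complete.\<close>

theorem proposition5:
  fixes scal :: "complex \<Rightarrow> 'a \<Rightarrow> 'a::{real_normed_algebra, banach}"
    and star :: "'a \<Rightarrow> 'a"
    and K :: "real set"
  assumes "cstar_algebra (UNIV :: 'a set) scal star norm"
    and "K \<subseteq> {-1..1}"
    and "0 islimpt K"
  shows
    "((\<forall>F\<in>abs_fps. (\<forall>t\<in>K. summable (fps_term scal F t)) \<and>
          bdd_above ((\<lambda>t. norm (\<Sum>n. fps_term scal F t n)) ` K)) \<and>
      complex_norm_on abs_fps (fps_scal scal) (fps_norm_on scal K)) \<and>
     (pre_cstar_algebra abs_fps (fps_scal scal) (fps_star star) (fps_norm_on scal K) \<and>
      ((\<exists>a::'a. a \<noteq> 0) \<longrightarrow>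
        \<not> cstar_algebra abs_fps (fps_scal scal) (fps_star star) (fps_norm_on scal K))) \<and>
     (\<forall>F\<in>abs_fps. fps_norm_on scal K F \<le> fps_l1_norm F) \<and>
     (\<forall>F\<in>abs_fps.
        (\<lambda>N. fps_norm_on scal K (fps_cutoff (Suc N) F - F)) \<longlonglongrightarrow> 0)"
proof -
  interpret cstar_series scal star K
    using assms by (simp add: cstar_series_def cstar_series_axioms_def)
  show ?thesis
    by (auto intro!: bdd_above_ev complex_norm_on_abs_fps pre_cstar_algebra_abs_fps
        fps_norm_on_le_l1 fps_norm_on_cutoff_tendsto
        intro: sums_summable[OF sums_ev] K_abs dest: not_cstar_algebra_abs_fps)
qed

end
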